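(* For all integers $n \ge 2$, we have $p_{n-1}+p_n \ge p_{n+1}$. Equality holds only for $n=2$.
   Context: For each integer $n \ge 1$, $p_n$ denotes the $n$th prime number, so $p_1=2$, $p_2=3$, $p_3=5$, and so on. *)

theory Defs
  imports "HOL-Library.Infinite_Set" "HOL-Computational_Algebra.Primes"
begin

text \<open>
  The primes are indexed from 1, whereas \<^const>\<open>enumerate\<close> lists the elements of an infinite
  set of naturals in increasing order starting at index 0. The value at index 0 is
  meaningless (by truncated subtraction it is again 2).
\<close>

definition nth_prime :: "nat \<Rightarrow> nat" where
  "nth_prime n = enumerate {q. prime q} (n - 1)"

lemma nth_prime_1: "nth_prime 1 = 2"
  unfolding nth_prime_def enumerate_0 diff_self_eq_0
  by (rule Least_equality) (auto simp: prime_ge_2_nat)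

lemma nth_prime_Suc:
  assumes "n \<ge> 1"
  shows "nth_prime (Suc n) = (LEAST q. prime q \<and> nth_prime n < q)"
  using assms enumerate_Suc''[OF primes_infinite, of "n - 1"]
  by (simp add: nth_prime_def)

end

theory Submission
  imports Defs "HOL.Binomial_Plus" "HOL-Library.Discrete_Functions"
begin

text \<open>
  It suffices that for \<open>x \<ge> 6\<close> there are two primes in \<open>(x, 2 x]\<close>: for \<open>x = p\<^sub>n\<^sub>-\<^sub>1\<close> they give
  \<open>p\<^sub>n\<^sub>+\<^sub>1 \<le> 2 x < p\<^sub>n\<^sub>-\<^sub>1 + p\<^sub>n\<close>. Erdos' proof of Bertrand's postulate has enough slack for this:
  in the factorisation of \<open>(2 x choose x)\<close>, every prime power is at most \<open>2 x\<close>, primes above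
  \<open>sqrt (2 x)\<close> occur at most once, and primes in \<open>(2 x / 3, x]\<close> do not occur; the primes
  up to \<open>2 x / 3\<close> have product at most \<open>4\<close> to the power \<open>2 x / 3\<close>. So if \<open>(x, 2 x]\<close>
  contained at most one prime, the central binomial coefficient would be too small once
  \<open>x \<ge> 512\<close>; smaller \<open>x\<close> are covered by an explicit chain of primes.
\<close>

section \<open>Prime powers dividing binomial coefficients\<close>

text \<open>Passing from \<open>n\<close> to \<open>Suc n\<close> raises \<open>n div p ^ k\<close>
  by one exactly when \<open>p ^ k\<close> divides \<open>Suc n\<close>, so for
  \<open>multiplicity p (Suc n)\<close> values of \<open>k\<close>. The free cutoff \<open>N\<close>
  lets \<open>fact n\<close> and \<open>fact (2 * n)\<close> be summed over one range.\<close>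

lemma multiplicity_fact_Legendre:
  fixes p :: nat
  assumes "prime p" "n \<le> N"
  shows "multiplicity p (fact n) = (\<Sum>k=1..N. n div p ^ k)"
  using assms(2)
proof (induction n)
  case 0
  then show ?case by simp
next
  case (Suc n)
  let ?m = "multiplicity p (Suc n)"
  have p: "p > 1" using assms(1) prime_gt_1_nat by blast
  have "?m < p ^ ?m" using p by (intro power_gt_expt) simp
  also have "p ^ ?m \<le> Suc n" by (intro dvd_imp_le multiplicity_dvd) auto
  finally have m: "?m \<le> N" using Suc.prems by simp
  have dvd: "p ^ k dvd Suc n \<longleftrightarrow> k \<le> ?m" for k
    using p by (intro power_dvd_iff_le_multiplicity) auto
  have "(\<Sum>k=1..N. Suc n div p ^ k) = (\<Sum>k=1..N. n div p ^ k + (if k \<le> ?m then 1 else 0))"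
    by (intro sum.cong) (auto simp: div_Suc dvd[symmetric] dvd_eq_mod_eq_0)
  also have "\<dots> = (\<Sum>k=1..N. n div p ^ k) + card {k \<in> {1..N}. k \<le> ?m}"
    by (simp add: sum.distrib sum.If_cases Int_def)
  also have "{k \<in> {1..N}. k \<le> ?m} = {1..?m}" using m by auto
  finally have "(\<Sum>k=1..N. Suc n div p ^ k) = (\<Sum>k=1..N. n div p ^ k) + ?m" by simp
  moreover have "multiplicity p (fact (Suc n) :: nat) = ?m + multiplicity p (fact n :: nat)"
    unfolding fact_Suc of_nat_id using assms(1)
    by (intro prime_elem_multiplicity_mult_distrib) auto
  ultimately show ?case using Suc by simp
qed

lemma double_div_le: "2 * n div d \<le> Suc (2 * (n div d))" for n d :: nat
proof (cases "d = 0")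
  case False
  then have "n < d * Suc (n div d)"
    using dividend_less_times_div by simp
  then have "2 * n < d * (2 * Suc (n div d))" by simp
  then have "2 * n div d < 2 * Suc (n div d)"
    using False by (simp add: less_mult_imp_div_less mult.commute)
  then show ?thesis by simp
qed simp

lemma double_div_ge: "2 * (n div d) \<le> 2 * n div d" for n d :: nat
  by (cases "d = 0") (simp_all add: less_eq_div_iff_mult_less_eq mult.assoc)

lemma multiplicity_central_binomial:
  fixes p :: nat
  assumes "prime p"
  shows "multiplicity p (2 * n choose n) = (\<Sum>k=1..2*n. 2 * n div p ^ k - 2 * (n div p ^ k))"
proof -
  have "fact n * fact n * (2 * n choose n) = (fact (2 * n) :: nat)"
    using binomial_fact_lemma[of n "2 * n"] by simp
  then have "multiplicity p (fact (2 * n) :: nat) = multiplicity p (fact n * fact n * (2 * n choose n))"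
    by simp
  also have "\<dots> = 2 * multiplicity p (fact n :: nat) + multiplicity p (2 * n choose n)"
    using assms by (simp add: prime_elem_multiplicity_mult_distrib)
  finally have "multiplicity p (2 * n choose n) =
      multiplicity p (fact (2 * n) :: nat) - 2 * multiplicity p (fact n :: nat)" by simp
  also have "\<dots> = (\<Sum>k=1..2*n. 2 * n div p ^ k) - (\<Sum>k=1..2*n. 2 * (n div p ^ k))"
    using multiplicity_fact_Legendre[OF assms, of "2 * n" "2 * n"]
      multiplicity_fact_Legendre[OF assms, of n "2 * n"]
    by (simp add: sum_distrib_left)
  \<comment> \<open>Truncated subtraction passes through the sum because each term dominates the one
    subtracted from it.\<close>
  also have "\<dots> = (\<Sum>k=1..2*n. 2 * n div p ^ k - 2 * (n div p ^ k))"
    by (rule sum_subtractf_nat[symmetric]) (rule double_div_ge)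
  finally show ?thesis .
qed

text \<open>Each term of the formula is at most 1 and vanishes once \<open>p ^ k > 2 * n\<close>.
  Were the claim false, only \<open>1 \<le> k < ?v\<close> could contribute, giving
  \<open>?v \<le> ?v - 1\<close>.\<close>

lemma prime_power_central_binomial_le:
  fixes p :: nat
  assumes "prime p" "n > 0"
  shows "p ^ multiplicity p (2 * n choose n) \<le> 2 * n"
proof (rule ccontr)
  let ?v = "multiplicity p (2 * n choose n)"
  assume gt: "\<not> ?thesis"
  have v: "?v > 0" using gt assms(2) by (cases "?v = 0") auto
  have p: "p > 1" using assms(1) prime_gt_1_nat by blast
  have "?v \<le> (\<Sum>k=1..2*n. if k < ?v then 1 else 0)"
    unfolding multiplicity_central_binomial[OF assms(1)]
  \<comment> \<open>The unfolding also rewrote \<open>?v\<close> inside the bound; folding restores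
    it there.\<close>
  proof (intro sum_mono, fold multiplicity_central_binomial[OF assms(1)])
    fix k
    show "2 * n div p ^ k - 2 * (n div p ^ k) \<le> (if k < ?v then 1 else 0)"
    proof (cases "k < ?v")
      case True
      then show ?thesis using double_div_le[of n "p ^ k"] by simp
    next
      case False
      then have "p ^ ?v \<le> p ^ k" using p by (intro power_increasing) auto
      then have "2 * n < p ^ k" using gt by simp
      then show ?thesis by simp
    qed
  qed
  also have "\<dots> = card {k \<in> {1..2*n}. k < ?v}"
    by (simp add: sum.If_cases Int_def)
  also have "\<dots> \<le> card {1..<?v}" by (intro card_mono) auto
  finally show False using v by simp
qed

lemma multiplicity_central_binomial_le_1:
  fixes p :: nat
  assumes "prime p" "n > 0" "2 * n < p\<^sup>2"
  shows "multiplicity p (2 * n choose n) \<le> 1"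
proof (rule ccontr)
  assume "\<not> ?thesis"
  then have "p ^ 2 \<le> p ^ multiplicity p (2 * n choose n)"
    using prime_gt_0_nat[OF assms(1)] by (intro power_increasing) auto
  then show False using prime_power_central_binomial_le[OF assms(1,2)] assms(3) by simp
qed

text \<open>The term for \<open>k = 1\<close> is \<open>2 - 2 * 1\<close>; for larger
  \<open>k\<close>, \<open>2 * n < 3 * p \<le> p * p\<close> makes both quotients zero.\<close>

lemma multiplicity_central_binomial_eq_0:
  fixes p :: nat
  assumes "prime p" "p > 2" "2 * n < 3 * p" "p \<le> n"
  shows "multiplicity p (2 * n choose n) = 0"
proof -
  have "2 * n div p ^ k - 2 * (n div p ^ k) = 0" if "k \<ge> 1" for k
  proof (cases "k = 1")
    case True
    have "n div p = 1" "2 * n div p = 2"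
      using assms by (intro div_nat_eqI; simp)+
    then show ?thesis using True by simp
  next
    case False
    have "2 * n < p * p"
      using assms(2,3) mult_le_mono1[of 3 p p] by linarith
    also have "p * p = p ^ 2" by (simp add: power2_eq_square)
    also have "p ^ 2 \<le> p ^ k" using that False assms(2) by (intro power_increasing) auto
    finally show ?thesis by simp
  qed
  then show ?thesis unfolding multiplicity_central_binomial[OF assms(1)] by simp
qed

section \<open>A bound for the product of the primes up to \<open>n\<close>\<close>

lemma prod_primes_dvd:
  fixes m :: nat
  assumes "finite A" "\<And>p. p \<in> A \<Longrightarrow> prime p" "\<And>p. p \<in> A \<Longrightarrow> p dvd m"
  shows "\<Prod>A dvd m"
  using assms
proof (induction A rule: finite_induct)
  case (insert p A)
  have "coprime p (\<Prod>A)"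
    using insert by (intro prod_coprime_right primes_coprime) auto
  then show ?case using insert by (auto intro: divides_mult)
qed simp

text \<open>The row \<open>Suc (2 * m)\<close> has two equal middle entries, and together they are
  at most the row sum \<open>2 * 4 ^ m\<close>.\<close>

lemma choose_middle_le: "Suc (2 * m) choose m \<le> 4 ^ m"
proof -
  have "(Suc (2 * m) choose m) + (Suc (2 * m) choose Suc m)
      = (\<Sum>k\<in>{m, Suc m}. Suc (2 * m) choose k)" by simp
  also have "\<dots> \<le> (\<Sum>k\<le>Suc (2 * m). Suc (2 * m) choose k)" by (intro sum_mono2) auto
  also have "\<dots> = 2 ^ Suc (2 * m)" by (rule choose_row_sum)
  also have "\<dots> = 2 * 4 ^ m" by (simp add: power_mult)
  finally show ?thesis
    using central_binomial_odd[of "Suc (2 * m)"] by simp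
qed

text \<open>An even \<open>n > 2\<close> is not prime, so \<open>n - 1\<close> gives the bound. For
  \<open>n = Suc (2 * m)\<close>, induction covers the primes up to \<open>Suc m\<close>, and the
  product of the others divides \<open>n choose m\<close>, which is at most
  \<open>4 ^ m\<close>.\<close>

lemma primorial_le: "\<Prod>{p. prime p \<and> p \<le> n} \<le> 4 ^ n" for n :: nat
proof (induction n rule: less_induct)
  case (less n)
  consider "n \<le> 1" | "n = 2" | "n > 2" "even n" | "n > 2" "odd n" by linarith
  then show ?case
  proof cases
    case 1
    then have "{p. prime p \<and> p \<le> n} = {}" by (auto dest: prime_ge_2_nat)
    then show ?thesis by (simp only: prod.empty) simp
  next
    case 2
    then have "{p. prime p \<and> p \<le> n} = {2}" by (auto dest: prime_ge_2_nat)
    then show ?thesis by (simp add: 2)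
  next
    case 3
    then have "\<not> prime n" using prime_odd_nat by auto
    then have "{p. prime p \<and> p \<le> n} = {p. prime p \<and> p \<le> n - 1}"
      by (auto simp: le_less Suc_le_eq)
    then have "\<Prod>{p. prime p \<and> p \<le> n} \<le> 4 ^ (n - 1)" using less[of "n - 1"] 3 by simp
    also have "\<dots> \<le> 4 ^ n" by (intro power_increasing) auto
    finally show ?thesis .
  next
    case 4
    then obtain m where m: "n = Suc (2 * m)" "m > 0" by (elim oddE) auto
    let ?A = "{p. prime p \<and> p \<le> Suc m}" and ?B = "{p. prime p \<and> Suc m < p \<and> p \<le> n}"
    \<comment> \<open>Such a prime divides \<open>fact n\<close>, but is too large to divide
      \<open>fact m\<close> or \<open>fact (Suc m)\<close>.\<close>
    have "p dvd n choose m" if "p \<in> ?B" for p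
    proof -
      have "p dvd fact n" using that by (simp add: prime_dvd_fact_iff)
      also have "fact n = fact m * fact (Suc m) * (n choose m)"
        using binomial_fact_lemma[of m n] m by (simp add: Suc_diff_le mult_2)
      finally show ?thesis
        using that unfolding prime_dvd_mult_iff[of p] 
        by (auto simp: prime_dvd_mult_iff prime_dvd_fact_iff simp del: fact_Suc)
    qed
    then have "\<Prod>?B dvd n choose m" by (intro prod_primes_dvd) auto
    then have "\<Prod>?B \<le> n choose m" by (rule dvd_imp_le) (use m in simp)
    also have "\<dots> \<le> 4 ^ m" unfolding m by (rule choose_middle_le)
    finally have B: "\<Prod>?B \<le> 4 ^ m" .
    have "{p. prime p \<and> p \<le> n} = ?A \<union> ?B" using m by auto
    then have "\<Prod>{p. prime p \<and> p \<le> n} = \<Prod>?A * \<Prod>?B"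
      by (simp add: prod.union_disjoint disjoint_iff)
    also have "\<dots> \<le> 4 ^ Suc m * 4 ^ m" using less[of "Suc m"] m B by (intro mult_mono) auto
    also have "\<dots> = 4 ^ n" by (simp add: m mult_2 power_add)
    finally show ?thesis .
  qed
qed

section \<open>Two primes between \<open>n\<close> and \<open>2 n\<close>\<close>

lemma central_binomial_le_if_few_primes:
  assumes "n > 2" and few: "card {p. prime p \<and> n < p \<and> p \<le> 2 * n} \<le> 1"
  shows "2 * n choose n \<le> (2 * n) ^ floor_sqrt (2 * n) * 4 ^ (2 * n div 3)"
proof -
  let ?f = "\<lambda>p. p ^ multiplicity p (2 * n choose n)"
  let ?s = "floor_sqrt (2 * n)"
  define A where "A = {p. prime p \<and> p\<^sup>2 \<le> 2 * n}"
  define B where "B = {p. prime p \<and> p\<^sup>2 > 2 * n \<and> p \<le> n}"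
  define C where "C = {p. prime p \<and> p\<^sup>2 > 2 * n \<and> n < p \<and> p \<le> 2 * n}"
  \<comment> \<open>Starting at 2 leaves at most \<open>?s - 1\<close> small primes; the exponent
    saved pays for the single prime that \<open>C\<close> may contain.\<close>
  have sA: "A \<subseteq> {2..?s}"
    by (auto simp: A_def prime_ge_2_nat le_floor_sqrt_iff)
  have s: "?s \<ge> 1" using assms(1) by (simp add: le_floor_sqrt_iff)
  have fin: "finite A" "finite B" "finite C"
    using finite_subset[OF sA] by (auto simp: B_def C_def)
  have cA: "card A \<le> ?s - 1" using card_mono[OF _ sA] by simp
  have cC: "card C \<le> 1"
  proof -
    have "card C \<le> card {p. prime p \<and> n < p \<and> p \<le> 2 * n}"
      unfolding C_def by (intro card_mono) auto
    then show ?thesis using few by simp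
  qed
  have le: "?f p \<le> 2 * n" if "prime p" for p
    using prime_power_central_binomial_le[of p n] that assms(1) by simp
  have pw: "prod ?f D \<le> (2 * n) ^ k" if "D \<subseteq> Collect prime" "card D \<le> k" for D k
    using that le assms(1) by (intro prod_le_power) auto
  have fA: "prod ?f A \<le> (2 * n) ^ (?s - 1)" by (rule pw) (use cA in \<open>auto simp: A_def\<close>)
  have fC: "prod ?f C \<le> (2 * n) ^ 1" by (rule pw) (use cC in \<open>auto simp: C_def\<close>)
  have "prod ?f B \<le> (\<Prod>p\<in>B. if p \<le> 2 * n div 3 then p else 1)"
  proof (intro prod_mono conjI)
    fix p assume "p \<in> B"
    then have p: "prime p" "p\<^sup>2 > 2 * n" "p \<le> n" by (auto simp: B_def)
    have "p > 2"
    proof (rule ccontr)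
      assume "\<not> p > 2"
      then have "p\<^sup>2 \<le> 2\<^sup>2" by (intro power_mono) auto
      then show False using p assms(1) by simp
    qed
    then show "?f p \<le> (if p \<le> 2 * n div 3 then p else 1)"
      using multiplicity_central_binomial_eq_0[of p n] multiplicity_central_binomial_le_1[of p n] p
        assms(1) power_increasing[of "multiplicity p (2 * n choose n)" 1 p]
      by auto
  qed auto
  also have "\<dots> = \<Prod>{p \<in> B. p \<le> 2 * n div 3}"
    using fin by (simp add: prod.inter_filter)
  also have "\<dots> \<le> \<Prod>{p. prime p \<and> p \<le> 2 * n div 3}"
    by (intro dvd_imp_le prod_dvd_prod_subset prod_pos) (auto simp: B_def prime_gt_0_nat)
  also have "\<dots> \<le> 4 ^ (2 * n div 3)" by (rule primorial_le)
  finally have fB: "prod ?f B \<le> 4 ^ (2 * n div 3)" .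
  have pf: "prime_factors (2 * n choose n) \<subseteq> A \<union> B \<union> C"
  proof
    fix p assume p: "p \<in> prime_factors (2 * n choose n)"
    then have "prime p" "p dvd 2 * n choose n" by auto
    have "(2 * n choose n) dvd fact (2 * n)"
      using binomial_fact_lemma[of n "2 * n"] by (metis dvd_triv_right le_add1 mult_2)
    then have "p dvd fact (2 * n)" using \<open>p dvd _\<close> dvd_trans by blast
    then have "p \<le> 2 * n" using \<open>prime p\<close> by (simp add: prime_dvd_fact_iff)
    then show "p \<in> A \<union> B \<union> C" using \<open>prime p\<close> by (auto simp: A_def B_def C_def)
  qed
  have "2 * n choose n = prod ?f (prime_factors (2 * n choose n))"
    by (rule prime_factorization_nat) simp
  \<comment> \<open>Primes that do not divide the coefficient contribute
    \<open>p ^ 0 = 1\<close>.\<close>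
  also have "\<dots> = prod ?f (A \<union> B \<union> C)"
  proof (rule prod.mono_neutral_left)
    show "finite (A \<union> B \<union> C)" using fin by simp
    show "\<forall>p\<in>A \<union> B \<union> C - prime_factors (2 * n choose n). ?f p = 1"
      by (auto simp: A_def B_def C_def prime_factors_multiplicity)
  qed (rule pf)
  also have "\<dots> = prod ?f A * prod ?f B * prod ?f C"
    using fin by (subst prod.union_disjoint, simp, simp, force simp: A_def B_def C_def)
      (subst prod.union_disjoint, auto simp: A_def B_def C_def)
  also have "\<dots> \<le> (2 * n) ^ (?s - 1) * 4 ^ (2 * n div 3) * (2 * n) ^ 1"
    using fA fB fC by (intro mult_mono) auto
  also have "\<dots> = (2 * n) ^ Suc (?s - 1) * 4 ^ (2 * n div 3)" by simp
  also have "Suc (?s - 1) = ?s" using s by simp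
  finally show ?thesis .
qed

lemma power_6_le_power_2: "t ^ 6 \<le> 2 ^ (t - 2)" if "t \<ge> 33" for t :: nat
  using that
proof (induction t rule: dec_induct)
  case base
  show ?case by simp
next
  case (step t)
  \<comment> \<open>The left side grows by a factor of at most \<open>(11 / 10) ^ 6 < 2\<close> per
    step, the right side by 2.\<close>
  have "(10 * Suc t) ^ 6 \<le> (11 * t) ^ 6" using step by (intro power_mono) auto
  then have "10 ^ 6 * Suc t ^ 6 \<le> 11 ^ 6 * t ^ 6" by (simp only: power_mult_distrib)
  then have "Suc t ^ 6 \<le> 2 * t ^ 6" by simp
  also have "\<dots> \<le> 2 * 2 ^ (t - 2)" using step by simp
  also have "\<dots> = 2 ^ Suc (t - 2)" by simp
  also have "Suc (t - 2) = Suc t - 2" using step by simp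
  finally show ?case .
qed

lemma two_primes_large:
  fixes n :: nat
  assumes "n \<ge> 512"
  shows "card {p. prime p \<and> n < p \<and> p \<le> 2 * n} \<ge> 2"
proof (rule ccontr)
  assume "\<not> ?thesis"
  then have few: "card {p. prime p \<and> n < p \<and> p \<le> 2 * n} \<le> 1" by simp
  define s where "s = floor_sqrt (2 * n)"
  have s2: "s\<^sup>2 \<le> 2 * n" "2 * n < (Suc s)\<^sup>2"
    unfolding s_def by (auto simp: Suc_floor_sqrt_power2_gt)
  \<comment> \<open>The threshold 512 is chosen so that \<open>2 * n \<ge> 32 ^ 2\<close>; then
    \<open>Suc s \<ge> 33\<close>, as \<open>power_6_le_power_2\<close> requires.\<close>
  have s32: "s \<ge> 32" using assms by (simp add: s_def le_floor_sqrt_iff)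
  have "real (4 ^ n) \<le> real (2 * n * (2 * n choose n))"
    using central_binomial_lower_bound[of n] assms by (simp add: field_simps)
  then have "4 ^ n \<le> 2 * n * (2 * n choose n)" by (simp only: of_nat_le_iff)
  also have "\<dots> \<le> 2 * n * ((2 * n) ^ s * 4 ^ (2 * n div 3))"
    unfolding s_def using central_binomial_le_if_few_primes[OF _ few] assms
    by (intro mult_left_mono) auto
  \<comment> \<open>Cubing removes the division by 3, after which \<open>4 ^ (2 * n)\<close> cancels
    and \<open>4 ^ n\<close> remains against a power with exponent of order
    \<open>s\<close>.\<close>
  finally have "(4 ^ n) ^ 3 \<le> ((2 * n) ^ Suc s * 4 ^ (2 * n div 3)) ^ 3"
    by (intro power_mono) (auto simp: mult.assoc)
  also have "\<dots> = (2 * n) ^ (3 * Suc s) * 4 ^ (2 * n div 3 * 3)"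
    by (simp only: power_mult_distrib power_mult[symmetric] mult.commute)
  also have "\<dots> \<le> (2 * n) ^ (3 * Suc s) * 4 ^ (2 * n)"
    by (intro mult_left_mono power_increasing) auto
  finally have "4 ^ n * 4 ^ (2 * n) \<le> (2 * n) ^ (3 * Suc s) * 4 ^ (2 * n)"
    by (simp only: power_mult[symmetric] power_add[symmetric]) (simp add: mult.commute)
  then have "4 ^ n \<le> (2 * n) ^ (3 * Suc s)" by simp
  also have "\<dots> \<le> ((Suc s)\<^sup>2) ^ (3 * Suc s)"
    using s2 by (intro power_mono) auto
  also have "\<dots> = (Suc s ^ 6) ^ Suc s" by (simp only: power_mult[symmetric]) simp
  also have "\<dots> \<le> (2 ^ (Suc s - 2)) ^ Suc s"
    using s32 by (intro power_mono power_6_le_power_2) auto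
  also have "\<dots> = 2 ^ ((s - 1) * (s + 1))"
    by (simp only: power_mult[symmetric]) (simp add: algebra_simps)
  also have "(s - 1) * (s + 1) < s\<^sup>2"
    using s32 by (cases s) (auto simp: power2_eq_square)
  then have "(2::nat) ^ ((s - 1) * (s + 1)) < 2 ^ s\<^sup>2" by simp
  also have "\<dots> \<le> 2 ^ (2 * n)" using s2 by (intro power_increasing) auto
  also have "\<dots> = 4 ^ n" by (simp add: power_mult)
  finally show False by simp
qed

lemma two_primes:
  fixes n :: nat
  assumes "n \<ge> 6"
  obtains p q where "prime p" "prime q" "n < p" "p < q" "q \<le> 2 * n"
proof (cases "n \<ge> 512")
  case True
  obtain S where S: "S \<subseteq> {p. prime p \<and> n < p \<and> p \<le> 2 * n}" "card S = 2"
    using obtain_subset_with_card_n[OF two_primes_large[OF True]] by metis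
  then obtain p q where "S = {p, q}" "p \<noteq> q" by (auto simp: card_2_iff)
  then show ?thesis using S that[of p q] that[of q p] by (cases "p < q") auto
next
  case False
  note * = that
  show ?thesis
  proof (rule ccontr)
    assume "\<not> ?thesis"
    \<comment> \<open>If \<open>b > n\<close>, then \<open>b\<close> and
      \<open>c \<le> 2 * a \<le> 2 * n\<close> would be the two primes sought. Each \<open>b\<close>
      serves as the next \<open>a\<close>, which drives \<open>n\<close> up to 547, contradicting
      \<open>n < 512\<close>.\<close>
    then have step: "b \<le> n" if "a \<le> n" "prime b" "prime c" "b < c" "c \<le> 2 * a" for a b c
      using that *[of b c] by fastforce
    from assms have "7 \<le> n" by (rule step[of _ 7 11]) simp_all
    then have "11 \<le> n" by (rule step[of _ 11 13]) simp_all
    then have "13 \<le> n" by (rule step[of _ 13 19]) simp_all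
    then have "19 \<le> n" by (rule step[of _ 19 23]) simp_all
    then have "23 \<le> n" by (rule step[of _ 23 37]) simp_all
    then have "37 \<le> n" by (rule step[of _ 37 43]) simp_all
    then have "43 \<le> n" by (rule step[of _ 43 73]) simp_all
    then have "73 \<le> n" by (rule step[of _ 73 83]) simp_all
    then have "83 \<le> n" by (rule step[of _ 83 139]) simp_all
    then have "139 \<le> n" by (rule step[of _ 139 163]) simp_all
    then have "163 \<le> n" by (rule step[of _ 163 277]) simp_all
    then have "277 \<le> n" by (rule step[of _ 277 317]) simp_all
    then have "317 \<le> n" by (rule step[of _ 317 547]) simp_all
    then have "547 \<le> n" by (rule step[of _ 547 631]) simp_all
    then show False using False by simp
  qed
qed

section \<open>Consecutive primes\<close>

lemma nth_prime_Suc_le: "n \<ge> 1 \<Longrightarrow> prime q \<Longrightarrow> nth_prime n < q \<Longrightarrow> nth_prime (Suc n) \<le> q"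
  by (simp add: nth_prime_Suc Least_le)

lemma nth_prime_less_Suc: "n \<ge> 1 \<Longrightarrow> nth_prime n < nth_prime (Suc n)"
  by (simp add: nth_prime_def primes_infinite enumerate_mono)

lemma nth_prime_mono: "m \<le> n \<Longrightarrow> nth_prime m \<le> nth_prime n"
  by (simp add: nth_prime_def primes_infinite enumerate_mono_le_iff diff_le_mono)

lemma nth_prime_Suc_eqI:
  assumes "n \<ge> 1" "prime q" "nth_prime n < q" "\<And>r. nth_prime n < r \<Longrightarrow> r < q \<Longrightarrow> \<not> prime r"
  shows "nth_prime (Suc n) = q"
  unfolding nth_prime_Suc[OF assms(1)]
  using assms(2-) by (intro Least_equality) (auto simp: not_less[symmetric])

lemma nth_prime_2: "nth_prime 2 = 3"
proof -
  have "prime (3::nat)" by simp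
  then show ?thesis using nth_prime_Suc_eqI[of 1 3] nth_prime_1 by (simp add: numeral_2_eq_2)
qed

lemma nth_prime_3: "nth_prime 3 = 5"
proof -
  have "\<not> prime r" if "3 < r" "r < 5" for r :: nat
  proof -
    have "r = 4" using that by simp
    then show ?thesis by simp
  qed
  then show ?thesis using nth_prime_Suc_eqI[of 2 5] nth_prime_2 by simp
qed

lemma nth_prime_4: "nth_prime 4 = 7"
proof -
  have "\<not> prime r" if "5 < r" "r < 7" for r :: nat
  proof -
    have "r = 6" using that by simp
    then show ?thesis by simp
  qed
  then show ?thesis using nth_prime_Suc_eqI[of 3 7] nth_prime_3 by simp
qed

text \<open>The indices 2 and 3 belong to the primes 3 and 5, which lie below the range of
  \<open>two_primes\<close>, and are checked by hand.\<close>

lemma nth_prime_Suc_Suc_less: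
  assumes "n \<ge> 2"
  shows "nth_prime (Suc (Suc n)) < nth_prime n + nth_prime (Suc n)"
proof -
  consider "n = 2" | "n = 3" | "n \<ge> 4" using assms by linarith
  then show ?thesis
  proof cases
    case 1
    then show ?thesis using nth_prime_2 nth_prime_3 nth_prime_4 by simp
  next
    case 2
    \<comment> \<open>An upper bound is enough here, since \<open>11 < 5 + 7\<close>.\<close>
    have "nth_prime 5 \<le> 11" using nth_prime_Suc_le[of 4 11] nth_prime_4 by simp
    then show ?thesis using 2 nth_prime_3 nth_prime_4 by simp
  next
    case 3
    then have "nth_prime n \<ge> 6" using nth_prime_mono[of 4 n] nth_prime_4 by simp
    then obtain p q where pq: "prime p" "prime q" "nth_prime n < p" "p < q" "q \<le> 2 * nth_prime n"
      by (rule two_primes)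
    have "nth_prime (Suc n) \<le> p" using 3 pq by (intro nth_prime_Suc_le) auto
    then have "nth_prime (Suc (Suc n)) \<le> q" using pq by (intro nth_prime_Suc_le) auto
    then show ?thesis using pq nth_prime_less_Suc[of n] 3 by simp
  qed
qed

theorem theorem2:
  fixes n :: nat
  assumes "n \<ge> 2"
  shows "nth_prime (n - 1) + nth_prime n \<ge> nth_prime (n + 1) \<and>
         (nth_prime (n - 1) + nth_prime n = nth_prime (n + 1) \<longleftrightarrow> n = 2)"
proof (cases "n = 2")
  case True
  then show ?thesis using nth_prime_1 nth_prime_2 nth_prime_3 by simp
next
  case False
  \<comment> \<open>For \<open>n \<ge> 3\<close> the strict inequality gives the bound and rules out
    equality at once.\<close>
  then show ?thesis using nth_prime_Suc_Suc_less[of "n - 1"] assms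
    by (cases n) auto
qed

end
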